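(* Suppose $\|g(x)-g(y)\|\le\kappa\|x-y\|$ for all $x,y\in\mathbb{R}^d$ with $\kappa\le 1$, and $\|g'(x)-g'(y)\|\le\gamma\|x-y\|$ for all $x,y\in\mathbb{R}^d$ with $\gamma>0$. Let $\{x_t\}$ be generated by AAP($m$) with $S_t$ and $Y_t$ of full column rank for all $t\ge 0$. Suppose there exist constants $T>0$ and $M>0$ such that, for all $t\ge T$, $J_t$ is invertible, $\sigma_{\min}(Y_t)\ge M\|f_t\|$, and $J_tG_t$ has full column rank. Then, when $\|f_t\|$ is small enough, $$\left|\,\theta_t-\frac{\|r_t^J\|}{\|f_t\|}\,\right|\le\mathcal{O}(\|f_t\|),$$ that is, there exist constants $C,\delta>0$ independent of $t$ such that $\left|\theta_t-\|r_t^J\|/\|f_t\|\right|\le C\|f_t\|$ for all $t\ge T$ with $\|f_t\|\le\delta$. Consequently, $\theta_t$ converges to $\|r_t^J\|/\|f_t\|$ (their difference tends to $0$) as $\|f_t\|$ approaches zero.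
   Context: $g:\mathbb{R}^d\to\mathbb{R}^d$ is continuously differentiable, with Jacobian $g'$, and $f(x):=g(x)-x$. $\|\cdot\|$ is the Euclidean norm for vectors and the induced 2-norm for matrices; $\sigma_{\min}$ is the smallest singular value. AAP($m$) (Alternating Anderson-Picard method), with integer $1\le m\le d$, damping ratios $\beta_t\ge 0$ and starting point $x_0\in\mathbb{R}^d$: for $t=0,1,2,\dots$ set $x_t^0:=x_t$, $x_t^{\ell}:=g(x_t^{\ell-1})$ for $1\le\ell\le m$, $f_t^\ell:=f(x_t^\ell)$ for $0\le\ell\le m$, and $f_t:=f_t^0=f(x_t)$. Let $\alpha_t=(\alpha_t^0,\dots,\alpha_t^m)\in\mathbb{R}^{m+1}$ minimize $\|\sum_{\ell=0}^m\alpha^\ell f_t^\ell\|^2$ subject to $\sum_{\ell=0}^m\alpha^\ell=1$, and set $x_{t+1}:=(1-\beta_t)\sum_{\ell=0}^m\alpha_t^\ell x_t^\ell+\beta_t\sum_{\ell=0}^m\alpha_t^\ell g(x_t^\ell)$. $S_t:=[s_t^0,\dots,s_t^{m-1}]$ and $Y_t:=[y_t^0,\dots,y_t^{m-1}]$ in $\mathbb{R}^{d\times m}$, where $s_t^\ell:=x_t^{\ell+1}-x_t^\ell$ and $y_t^\ell:=f_t^{\ell+1}-f_t^\ell$. (Full column rank of $S_t$ forces $f_t=s_t^0\neq 0$.) $J_t:=f'(x_t)$ and $G_t:=[f_t,\ g'(x_t)f_t,\ g'(x_t)^2f_t,\ \dots,\ g'(x_t)^{m-1}f_t]\in\mathbb{R}^{d\times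 m}$ (matrix powers). $\mathcal{K}_n(A,b):=\mathrm{span}\{b,Ab,\dots,A^{n-1}b\}$. Optimization gain: $\theta_t:=\|\sum_{\ell=0}^m\alpha_t^\ell f_t^\ell\|/\|f_t\|$. Newton-GMRES($m$) gain: $\|r_t^J\|/\|f_t\|$, where $\|r_t^J\|:=\min_{p\in\mathcal{K}_m(J_t,f_t)}\|J_tp-f_t\|$. *)

theory Defs
  imports "HOL-Analysis.Analysis"
begin

(* The columns of a d x m matrix are indexed by a finite linearly ordered type 'm with m
   elements; a column index is identified with its position 0, ..., m - 1 in that order. *)
definition col_pos :: "'m::{finite,linorder} \<Rightarrow> nat" where
  "col_pos j = card {i. i < j}"

definition matrix_of_cols :: "(nat \<Rightarrow> real^'d) \<Rightarrow> real^'m::{finite,linorder}^'d" where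
  "matrix_of_cols v = (\<chi> i j. v (col_pos j) $ i)"

definition full_column_rank :: "real^'n^'d \<Rightarrow> bool" where
  "full_column_rank A \<longleftrightarrow> rank A = CARD('n)"

definition matrix_norm :: "real^'n^'d \<Rightarrow> real" where
  "matrix_norm A = onorm (\<lambda>v. A *v v)"

(* The singular values of a d x n matrix with n <= d: the square roots of the eigenvalues of
   the n x n Gram matrix.  This set is finite and nonempty. *)
definition singular_values :: "real^'n^'d \<Rightarrow> real set" where
  "singular_values A =
     {sqrt l | l. \<exists>v. v \<noteq> 0 \<and> (transpose A ** A) *v v = l *\<^sub>R v}"

definition sigma_min :: "real^'n^'d \<Rightarrow> real" where
  "sigma_min A = Min (singular_values A)"

(* On real^'n^'n the operation (^) is componentwise. *)
primrec matrix_power :: "real^'n^'n \<Rightarrow> nat \<Rightarrow> real^'n^'n" where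
  "matrix_power A 0 = mat 1"
| "matrix_power A (Suc k) = A ** matrix_power A k"

definition krylov :: "nat \<Rightarrow> real^'d^'d \<Rightarrow> real^'d \<Rightarrow> (real^'d) set" where
  "krylov n A b = span ((\<lambda>k. matrix_power A k *v b) ` {..<n})"

definition resid :: "(real^'d \<Rightarrow> real^'d) \<Rightarrow> real^'d \<Rightarrow> real^'d" where
  "resid g x = g x - x"

definition picard :: "(real^'d \<Rightarrow> real^'d) \<Rightarrow> real^'d \<Rightarrow> nat \<Rightarrow> real^'d" where
  "picard g x l = (g ^^ l) x"

definition mixed_resid ::
  "(real^'d \<Rightarrow> real^'d) \<Rightarrow> nat \<Rightarrow> real^'d \<Rightarrow> (nat \<Rightarrow> real) \<Rightarrow> real^'d" where
  "mixed_resid g m x a = (\<Sum>l\<le>m. a l *\<^sub>R resid g (picard g x l))"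

(* The iterates x and the mixing coefficients \<alpha> form a run of AAP(m).  Only the entries
   \<alpha> t 0, ..., \<alpha> t m matter.  The coefficients are any minimizer. *)
definition AAP ::
  "(real^'d \<Rightarrow> real^'d) \<Rightarrow> nat \<Rightarrow> (nat \<Rightarrow> real) \<Rightarrow> (nat \<Rightarrow> real^'d) \<Rightarrow>
     (nat \<Rightarrow> nat \<Rightarrow> real) \<Rightarrow> bool" where
  "AAP g m \<beta> x \<alpha> \<longleftrightarrow>
     (\<forall>t. is_arg_min (\<lambda>a. (norm (mixed_resid g m (x t) a))\<^sup>2) (\<lambda>a. (\<Sum>l\<le>m. a l) = 1) (\<alpha> t)
        \<and> x (Suc t) = (1 - \<beta> t) *\<^sub>R (\<Sum>l\<le>m. \<alpha> t l *\<^sub>R picard g (x t) l)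
                      + \<beta> t *\<^sub>R (\<Sum>l\<le>m. \<alpha> t l *\<^sub>R g (picard g (x t) l)))"

definition S_mat ::
  "(real^'d \<Rightarrow> real^'d) \<Rightarrow> real^'d \<Rightarrow> real^'m::{finite,linorder}^'d" where
  "S_mat g x = matrix_of_cols (\<lambda>l. picard g x (Suc l) - picard g x l)"

definition Y_mat ::
  "(real^'d \<Rightarrow> real^'d) \<Rightarrow> real^'d \<Rightarrow> real^'m::{finite,linorder}^'d" where
  "Y_mat g x = matrix_of_cols (\<lambda>l. resid g (picard g x (Suc l)) - resid g (picard g x l))"

definition J_mat :: "(real^'d \<Rightarrow> real^'d) \<Rightarrow> real^'d \<Rightarrow> real^'d^'d" where
  "J_mat g x = jacobian (resid g) (at x)"

definition G_mat ::
  "(real^'d \<Rightarrow> real^'d) \<Rightarrow> real^'d \<Rightarrow> real^'m::{finite,linorder}^'d" where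
  "G_mat g x = matrix_of_cols (\<lambda>k. matrix_power (jacobian g (at x)) k *v resid g x)"

definition opt_gain ::
  "(real^'d \<Rightarrow> real^'d) \<Rightarrow> nat \<Rightarrow> real^'d \<Rightarrow> (nat \<Rightarrow> real) \<Rightarrow> real" where
  "opt_gain g m x a = norm (mixed_resid g m x a) / norm (resid g x)"

(* The infimum is attained, the Krylov space being finite-dimensional. *)
definition gmres_resid :: "(real^'d \<Rightarrow> real^'d) \<Rightarrow> nat \<Rightarrow> real^'d \<Rightarrow> real" where
  "gmres_resid g m x =
     (INF p\<in>krylov m (J_mat g x) (resid g x). norm (J_mat g x *v p - resid g x))"

definition gmres_gain :: "(real^'d \<Rightarrow> real^'d) \<Rightarrow> nat \<Rightarrow> real^'d \<Rightarrow> real" where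
  "gmres_gain g m x = gmres_resid g m x / norm (resid g x)"

end

theory Submission
  imports Defs
begin

text \<open>
  Both residuals are distances from \<open>f\<^sub>t\<close> to a subspace: eliminating the affine constraint turns the
  mixed residual into the distance to the column space of \<open>Y\<^sub>t\<close>, and since \<open>J\<^sub>t\<close> and \<open>g'(x\<^sub>t)\<close> differ
  by the identity they generate the same Krylov spaces, so the GMRES residual is the distance to the
  column space of \<open>J\<^sub>t G\<^sub>t\<close>.  Linearizing \<open>g\<close> along the Picard steps, whose residuals never exceed
  \<open>f\<^sub>t\<close> in norm, shows that \<open>Y\<^sub>t\<close> and \<open>J\<^sub>t G\<^sub>t\<close> differ by a quantity quadratic in the norm of \<open>f\<^sub>t\<close>,
  whereas \<open>\<sigma>\<^sub>m\<^sub>i\<^sub>n(Y\<^sub>t)\<close> is at least linear in it.  So the optimal coefficients of both least squares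
  problems stay bounded, the two distances differ by a quadratic quantity, and dividing by the norm
  of \<open>f\<^sub>t\<close> leaves a linear one.
\<close>

section \<open>Column indexing and column spaces\<close>

lemma bij_betw_col_pos:
  "bij_betw (col_pos :: 'm::{finite,linorder} \<Rightarrow> nat) UNIV {..<CARD('m)}"
proof -
  have mono: "col_pos i < col_pos j" if "i < j" for i j :: 'm
    unfolding col_pos_def by (rule psubset_card_mono) (use that in force)+
  have inj: "inj (col_pos :: 'm \<Rightarrow> nat)"
    by (rule injI) (metis mono less_irrefl linorder_neqE)
  have "col_pos j < CARD('m)" for j :: 'm
    unfolding col_pos_def by (rule psubset_card_mono) auto
  then have "range (col_pos :: 'm \<Rightarrow> nat) = {..<CARD('m)}"
    by (intro card_subset_eq) (auto simp: card_image[OF inj])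
  with inj show ?thesis by (simp add: bij_betw_def)
qed

lemma col_pos_less: "col_pos (j :: 'm::{finite,linorder}) < CARD('m)"
  using bij_betw_col_pos by (auto simp: bij_betw_def)

lemma column_matrix_of_cols: "column j (matrix_of_cols v) = v (col_pos j)"
  by (simp add: column_def matrix_of_cols_def vec_eq_iff)

lemma range_matrix_vector_mult:
  fixes A :: "real^'n^'d"
  shows "range ((*v) A) = span (columns A)"
proof
  show "range ((*v) A) \<subseteq> span (columns A)"
    by (auto intro: matrix_vector_mult_in_columnspace)
  have "columns A \<subseteq> range ((*v) A)"
    by (auto simp: columns_def image_iff) (metis matrix_vector_mult_basis)
  then show "span (columns A) \<subseteq> range ((*v) A)"
    by (intro span_minimal) (simp_all add: linear_subspace_image)
qed

lemma range_matrix_of_cols: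
  fixes v :: "nat \<Rightarrow> real^'d"
  shows "range ((*v) (matrix_of_cols v :: real^'m::{finite,linorder}^'d)) = span (v ` {..<CARD('m)})"
proof -
  have "columns (matrix_of_cols v :: real^'m::{finite,linorder}^'d) = v ` range (col_pos :: 'm \<Rightarrow> nat)"
    by (auto simp: columns_def column_matrix_of_cols)
  then show ?thesis
    using bij_betw_col_pos[where 'm='m] by (simp add: range_matrix_vector_mult bij_betw_def)
qed

lemma matrix_mult_matrix_of_cols:
  "A ** matrix_of_cols v = matrix_of_cols (\<lambda>l. A *v v l)"
  by (simp add: matrix_of_cols_def matrix_matrix_mult_def matrix_vector_mult_def)

text \<open>Each entry of \<open>c\<close> is at most \<open>norm c\<close> in absolute value, so
  every column error enters with that weight. The crude sum costs a factor \<open>CARD('m)\<close>,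
  which does not depend on the iterate.\<close>

lemma norm_matrix_of_cols_mult_diff_le:
  fixes a b :: "nat \<Rightarrow> real^'d" and c :: "(real, 'm::{finite,linorder}) vec"
  assumes "\<And>l. l < CARD('m::{finite,linorder}) \<Longrightarrow> norm (a l - b l) \<le> e"
  shows "norm (matrix_of_cols a *v c - matrix_of_cols b *v c) \<le> real CARD('m) * e * norm c"
proof -
  have "matrix_of_cols a *v c - matrix_of_cols b *v c
      = (\<Sum>j\<in>UNIV. c $ j *\<^sub>R (a (col_pos j) - b (col_pos j)))"
    by (simp add: matrix_mult_sum column_matrix_of_cols scalar_mult_eq_scaleR
        sum_subtractf scaleR_diff_right)
  also have "norm \<dots> \<le> (\<Sum>j\<in>(UNIV :: 'm set). norm c * e)"
    by (intro sum_norm_le) (auto intro!: mult_mono assms col_pos_less component_le_norm_cart)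
  finally show ?thesis by (simp add: mult_ac)
qed

section \<open>Perturbation of the distance to a column space\<close>

text \<open>The point of the column space of \<open>A\<close> nearest to \<open>f\<close> has norm
  at most \<open>2 * norm f\<close>, because 0 competes. The lower bound on \<open>A\<close> then
  bounds its coefficients, and \<open>B\<close> applied to the same coefficients is a competitor for
  the other distance.\<close>

lemma infdist_range_perturbation:
  fixes A B :: "real^'n^'d"
  assumes "\<mu> > 0" "e \<ge> 0"
    and lower: "\<And>v. \<mu> * norm v \<le> norm (A *v v)"
    and close: "\<And>v. norm (A *v v - B *v v) \<le> e * norm v"
  shows "infdist f (range ((*v) B)) \<le> infdist f (range ((*v) A)) + 2 * e * norm f / \<mu>"
proof -
  have "closed (range ((*v) A))"
    by (intro closed_subspace linear_subspace_image) simp_all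
  then obtain c where c: "infdist f (range ((*v) A)) = dist f (A *v c)"
    using infdist_attains_inf[of "range ((*v) A)" f] by auto
  have "A *v 0 \<in> range ((*v) A)" by blast
  then have "dist f (A *v c) \<le> norm f"
    using infdist_le[of "A *v 0" "range ((*v) A)" f] c by simp
  then have "norm (A *v c) \<le> 2 * norm f"
    using norm_triangle_ineq2[of "A *v c" f] by (simp add: dist_norm norm_minus_commute)
  with lower[of c] have "norm c \<le> 2 * norm f / \<mu>"
    using \<open>\<mu> > 0\<close> by (simp add: field_simps)
  then have "e * norm c \<le> e * (2 * norm f / \<mu>)"
    using \<open>e \<ge> 0\<close> by (rule mult_left_mono)
  moreover have "infdist f (range ((*v) B)) \<le> dist f (B *v c)"
    by (intro infdist_le) simp
  moreover have "dist f (B *v c) \<le> dist f (A *v c) + norm (A *v c - B *v c)"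
    by (metis dist_norm dist_triangle)
  ultimately show ?thesis using close[of c] c by (simp add: mult_ac)
qed

section \<open>Gram eigenvalues and the smallest singular value\<close>

lemma Gram_eigenvector_iff:
  fixes A :: "real^'n^'d"
  shows "(transpose A ** A) *v v = l *\<^sub>R v \<longleftrightarrow> (\<forall>w. (A *v v) \<bullet> (A *v w) = l * (v \<bullet> w))"
proof -
  have "((transpose A ** A) *v v) \<bullet> w = (A *v v) \<bullet> (A *v w)" for w
    by (metis dot_lmul_matrix matrix_vector_mul_assoc transpose_matrix_vector)
  then show ?thesis
    by (metis (no_types, lifting) inner_scaleR_left vector_eq_rdot)
qed

text \<open>\<open>sigma_min\<close> is a \<open>Min\<close>, which bounds the members of a set only
  if the set is finite. Eigenvectors of the symmetric Gram matrix for distinct eigenvalues are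
  orthogonal, hence independent, so there are finitely many eigenvalues.\<close>

lemma finite_singular_values:
  fixes A :: "real^'n^'d"
  shows "finite (singular_values A)"
proof -
  define E where "E = {l. \<exists>v. v \<noteq> 0 \<and> (transpose A ** A) *v v = l *\<^sub>R v}"
  have "\<forall>l\<in>E. \<exists>v. v \<noteq> 0 \<and> (transpose A ** A) *v v = l *\<^sub>R v"
    by (simp add: E_def)
  then obtain u where u: "\<And>l. l \<in> E \<Longrightarrow> u l \<noteq> 0 \<and> (transpose A ** A) *v u l = l *\<^sub>R u l"
    by (auto dest!: bchoice)
  have orth: "u k \<bullet> u l = 0" if "k \<in> E" "l \<in> E" "k \<noteq> l" for k l
  proof -
    have "k * (u k \<bullet> u l) = l * (u l \<bullet> u k)"
      using u that by (metis Gram_eigenvector_iff inner_commute)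
    then show ?thesis using that by (simp add: inner_commute)
  qed
  have inj: "inj_on u E"
  proof (rule inj_onI)
    fix k l assume "k \<in> E" "l \<in> E" "u k = u l"
    then show "k = l" using orth[of k l] u[of k] by auto
  qed
  have "pairwise orthogonal (u ` E)"
    by (auto simp: pairwise_def orthogonal_def intro: orth)
  then have "independent (u ` E)"
    by (rule pairwise_orthogonal_independent) (use u in auto)
  then have "finite E"
    using finite_imageD[OF _ inj] independent_bound by blast
  moreover have "singular_values A = sqrt ` E"
    by (auto simp: singular_values_def E_def)
  ultimately show ?thesis by simp
qed

text \<open>A minimizer \<^term>\<open>u\<close> of \<^term>\<open>norm (A *v v)\<close> over the unit sphere is an eigenvector of the
  Gram matrix: the form \<^term>\<open>(norm (A *v v))\<^sup>2 - l * (norm v)\<^sup>2\<close> is nonnegative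
  and vanishes at \<^term>\<open>u\<close>, so its polar form vanishes there too.\<close>

lemma sigma_min_mult_norm_le:
  fixes A :: "real^'n^'d"
  shows "sigma_min A * norm v \<le> norm (A *v v)"
proof -
  have "continuous_on (sphere 0 1) (\<lambda>v. norm (A *v v))"
    by (intro continuous_intros matrix_vector_mult_linear_continuous_on)
  moreover have "sphere (0 :: real^'n) 1 \<noteq> {}" by simp
  ultimately obtain u where u: "norm u = 1"
    and least: "\<And>v. norm v = 1 \<Longrightarrow> norm (A *v u) \<le> norm (A *v v)"
    using continuous_attains_inf[OF compact_sphere] by (metis mem_sphere_0)
  have lower: "norm (A *v u) * norm v \<le> norm (A *v v)" for v
  proof (cases "v = 0")
    case False
    have "norm (A *v u) \<le> norm (A *v (v /\<^sub>R norm v))"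
      by (rule least) (use False in simp)
    also have "\<dots> = norm (A *v v) / norm v"
      by (simp add: matrix_vector_mult_scaleR divide_inverse mult.commute)
    finally show ?thesis using False by (simp add: field_simps)
  qed simp
  define l where "l = (norm (A *v u))\<^sup>2"
  have "(A *v u) \<bullet> (A *v w) = l * (u \<bullet> w)" for w
  proof (rule ccontr)
    assume neq: "(A *v u) \<bullet> (A *v w) \<noteq> l * (u \<bullet> w)"
    \<comment> \<open>Along the line \<open>u + s *\<^sub>R w\<close> the nonnegative form equals
      \<open>2 * s * b + s\<^sup>2 * q\<close>, so a nonzero \<open>b\<close> would make it negative
      for some small \<open>s\<close>.\<close>
    define b where "b = (A *v u) \<bullet> (A *v w) - l * (u \<bullet> w)"
    define q where "q = (norm (A *v w))\<^sup>2 - l * (norm w)\<^sup>2"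
    have "b \<noteq> 0" using neq by (simp add: b_def)
    have expand: "0 \<le> 2 * s * b + s\<^sup>2 * q" for s
    proof -
      have "l * (norm (u + s *\<^sub>R w))\<^sup>2 \<le> (norm (A *v (u + s *\<^sub>R w)))\<^sup>2"
        unfolding l_def power_mult_distrib[symmetric] by (intro power_mono lower) simp
      moreover have "u \<bullet> u = 1" "(A *v u) \<bullet> (A *v u) = l"
        using u by (simp_all add: dot_square_norm l_def)
      ultimately show ?thesis
        by (simp add: b_def q_def power2_norm_eq_inner matrix_vector_right_distrib
            matrix_vector_mult_scaleR inner_simps inner_commute[of w u]
            inner_commute[of "A *v w" "A *v u"])
          (simp add: algebra_simps power2_eq_square)
    qed
    have q: "q \<ge> 0"
      using power_mono[OF lower[of w], of 2] by (simp add: q_def l_def power_mult_distrib)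
    \<comment> \<open>The quadratic is least at \<open>s = - b / q\<close>; the denominator
      \<open>q + 1\<close> also covers \<open>q = 0\<close> and still gives a negative
      value.\<close>
    have "2 * (- b / (q + 1)) * b + (- b / (q + 1))\<^sup>2 * q = - (b\<^sup>2 * (q + 2)) / (q + 1)\<^sup>2"
      using q by (simp add: divide_simps) (simp add: algebra_simps power2_eq_square)
    also have "\<dots> < 0"
      using q \<open>b \<noteq> 0\<close> by (intro divide_neg_pos) auto
    finally show False using expand[of "- b / (q + 1)"] by linarith
  qed
  then have "sqrt l \<in> singular_values A"
    using u unfolding singular_values_def Gram_eigenvector_iff by (auto intro!: exI[of _ l] exI[of _ u])
  then have "sigma_min A \<le> norm (A *v u)"
    unfolding sigma_min_def l_def using Min_le[OF finite_singular_values] by fastforce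
  then show ?thesis
    by (rule order_trans[OF mult_right_mono lower]) simp
qed

section \<open>Krylov spaces under a shift of the matrix\<close>

lemma krylov_mono: "m \<le> n \<Longrightarrow> krylov m A b \<subseteq> krylov n A b"
  unfolding krylov_def by (intro span_mono image_mono) auto

lemma krylov_mult:
  assumes "p \<in> krylov n A b"
  shows "A *v p \<in> krylov (Suc n) A b"
proof -
  have "(*v) A ` krylov n A b = span ((\<lambda>k. matrix_power A (Suc k) *v b) ` {..<n})"
    unfolding krylov_def
    by (simp add: image_image matrix_vector_mul_assoc flip: linear_span_image)
  also have "\<dots> \<subseteq> krylov (Suc n) A b"
    unfolding krylov_def by (rule span_mono) (auto simp: image_iff simp del: matrix_power.simps)
  finally show ?thesis using assms by blast
qed

text \<open>\<open>B\<close> is \<open>A\<close> plus a multiple of the identity, so its k-th power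
  is a polynomial of degree k in \<open>A\<close>.\<close>

lemma krylov_shift_subset:
  fixes A B :: "real^'d^'d"
  assumes B: "\<And>v. B *v v = A *v v + c *\<^sub>R v"
  shows "krylov n B b \<subseteq> krylov n A b"
proof -
  \<comment> \<open>\<open>krylov\<close> counts generators starting from power 0, so the k-th power
    needs \<open>Suc k\<close> of them.\<close>
  have mem: "matrix_power B k *v b \<in> krylov (Suc k) A b" for k
  proof (induction k)
    case 0
    show ?case by (auto simp: krylov_def intro: span_base)
  next
    case (Suc k)
    have "matrix_power B (Suc k) *v b = A *v (matrix_power B k *v b) + c *\<^sub>R (matrix_power B k *v b)"
      by (simp add: B flip: matrix_vector_mul_assoc)
    moreover have "matrix_power B k *v b \<in> krylov (Suc (Suc k)) A b"
      using Suc krylov_mono[of "Suc k" "Suc (Suc k)"] by auto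
    ultimately show ?case
      using krylov_mult[OF Suc] unfolding krylov_def by (simp add: span_add span_scale)
  qed
  have "(\<lambda>k. matrix_power B k *v b) ` {..<n} \<subseteq> krylov n A b"
  proof (rule image_subsetI)
    fix k assume "k \<in> {..<n}"
    then show "matrix_power B k *v b \<in> krylov n A b"
      using mem[of k] krylov_mono[of "Suc k" n A b] by auto
  qed
  then show ?thesis
    unfolding krylov_def by (intro span_minimal) auto
qed

section \<open>Elimination of the affine constraint\<close>

text \<open>Telescoping puts every \<open>u l - u 0\<close> into the span of consecutive
  differences. With \<open>u\<close> the Picard residuals, these differences are the columns of
  \<open>Y_mat\<close>.\<close>

lemma affine_combinations_eq_span_differences:
  fixes u :: "nat \<Rightarrow> 'a::real_vector"
  shows "{\<Sum>l\<le>m. a l *\<^sub>R u l | a. (\<Sum>l\<le>m. a l) = (1 :: real)}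
    = (\<lambda>p. u 0 - p) ` span ((\<lambda>l. u (Suc l) - u l) ` {..<m})" (is "?L = _ ` span ?D")
proof (intro subset_antisym subsetI)
  fix p assume "p \<in> ?L"
  then obtain a where p: "p = (\<Sum>l\<le>m. a l *\<^sub>R u l)" and a: "(\<Sum>l\<le>m. a l) = (1 :: real)" by auto
  have diff: "u l - u 0 \<in> span ?D" if "l \<le> m" for l
    using that
  proof (induction l)
    case (Suc l)
    then have "u (Suc l) - u l \<in> span ?D" "u l - u 0 \<in> span ?D"
      by (auto intro: span_base)
    then have "(u l - u 0) + (u (Suc l) - u l) \<in> span ?D"
      by (rule span_add[rotated])
    then show ?case by simp
  qed (simp add: span_zero)
  have "u 0 - p = - (\<Sum>l\<le>m. a l *\<^sub>R (u l - u 0))"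
    using a by (simp add: p scaleR_diff_right sum_subtractf flip: scaleR_sum_left)
  also have "\<dots> \<in> span ?D"
    by (intro span_neg span_sum span_scale diff) simp
  finally show "p \<in> (\<lambda>p. u 0 - p) ` span ?D"
    by (force simp: image_iff intro: bexI[of _ "u 0 - p"])
next
  fix p assume "p \<in> (\<lambda>p. u 0 - p) ` span ?D"
  then obtain q where p: "p = u 0 - q" and q: "q \<in> span ?D" by auto
  \<comment> \<open>The zero-sum combinations form a subspace containing the consecutive
    differences, hence their whole span; subtracting one from \<open>u 0\<close> leaves weights of
    sum 1.\<close>
  define V where "V = {\<Sum>l\<le>m. a l *\<^sub>R u l | a. (\<Sum>l\<le>m. a l) = (0 :: real)}"
  have "subspace V"
    unfolding subspace_def V_def
  proof (safe, goal_cases)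
    case 1
    show ?case by (intro exI[of _ "\<lambda>_. 0"]) simp
  next
    case (2 _ _ a b)
    then show ?case
      by (intro exI[of _ "\<lambda>l. a l + b l"]) (simp add: scaleR_left_distrib sum.distrib)
  next
    case (3 c _ a)
    then show ?case
      by (intro exI[of _ "\<lambda>l. c * a l"]) (simp add: scaleR_sum_right flip: sum_distrib_left)
  qed
  moreover have "u (Suc l) - u l \<in> V" if "l < m" for l
    unfolding V_def using that
    by (intro CollectI exI[of _ "\<lambda>j. of_bool (j = Suc l) - of_bool (j = l)"])
      (simp add: scaleR_left_diff_distrib sum_subtractf of_bool_def if_distrib[of "\<lambda>r. r *\<^sub>R _"] cong: if_cong)
  ultimately have "q \<in> V"
    using q span_minimal[of ?D V] by blast
  then obtain a where a: "q = (\<Sum>l\<le>m. a l *\<^sub>R u l)" "(\<Sum>l\<le>m. a l) = (0 :: real)"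
    by (auto simp: V_def)
  have "p = (\<Sum>l\<le>m. (of_bool (l = 0) - a l) *\<^sub>R u l)"
    by (simp add: p a scaleR_left_diff_distrib sum_subtractf of_bool_def if_distrib[of "\<lambda>r. r *\<^sub>R _"] cong: if_cong)
  moreover have "(\<Sum>l\<le>m. of_bool (l = 0) - a l) = 1"
    using a by (simp add: sum_subtractf of_bool_def)
  ultimately show "p \<in> ?L"
    by (intro CollectI exI[of _ "\<lambda>l. of_bool (l = 0) - a l"] conjI)
qed

section \<open>Linearization along the Picard steps of a nonexpansive map\<close>

text \<open>Difference quotients in direction \<open>h\<close> are bounded by
  \<open>K * norm h\<close>, and the derivative is their limit. The tolerance
  \<open>e / norm h\<close> leaves exactly the error \<open>e\<close> after division by the step
  \<open>s\<close>.\<close>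

lemma norm_has_derivative_Lipschitz_le:
  assumes f': "(f has_derivative f') (at z)"
    and f: "\<And>y. norm (f y - f z) \<le> K * norm (y - z)"
  shows "norm (f' h) \<le> K * norm h"
proof (cases "h = 0")
  case True
  then show ?thesis
    using linear_0[OF has_derivative_linear[OF f']] by simp
next
  case False
  interpret f': linear f' by (rule has_derivative_linear[OF f'])
  show ?thesis
  proof (rule field_le_epsilon)
    fix e :: real assume "e > 0"
    then have "e / norm h > 0" using False by simp
    then obtain d where "d > 0"
      and d: "\<And>y. norm (y - z) < d \<Longrightarrow> norm (f y - f z - f' (y - z)) \<le> e / norm h * norm (y - z)"
      using f' unfolding has_derivative_at_alt by blast
    define s where "s = d / (2 * norm h)"
    have "s > 0" using False \<open>d > 0\<close> by (simp add: s_def)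
    have "s * norm h < d" using False \<open>d > 0\<close> by (simp add: s_def)
    then have "norm (f (z + s *\<^sub>R h) - f z - s *\<^sub>R f' h) \<le> e / norm h * (s * norm h)"
      using d[of "z + s *\<^sub>R h"] \<open>s > 0\<close> by (simp add: f'.scaleR)
    moreover have "norm (f (z + s *\<^sub>R h) - f z) \<le> K * (s * norm h)"
      using f[of "z + s *\<^sub>R h"] \<open>s > 0\<close> by simp
    moreover have "norm (s *\<^sub>R f' h) \<le> norm (f (z + s *\<^sub>R h) - f z)
        + norm (f (z + s *\<^sub>R h) - f z - s *\<^sub>R f' h)"
      using norm_triangle_ineq4[of "f (z + s *\<^sub>R h) - f z" "f (z + s *\<^sub>R h) - f z - s *\<^sub>R f' h"]
      by simp
    ultimately have "s * norm (f' h) \<le> s * (K * norm h + e)"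
      using \<open>s > 0\<close> False by (simp add: algebra_simps)
    then show "norm (f' h) \<le> K * norm h + e"
      using \<open>s > 0\<close> by simp
  qed
qed

locale smooth_nonexpansive =
  fixes g :: "real^'d \<Rightarrow> real^'d" and \<gamma> :: real
  assumes differentiable: "g differentiable (at z)"
    and nonexpansive: "norm (g y - g z) \<le> norm (y - z)"
    and jacobian_Lipschitz:
      "matrix_norm (jacobian g (at y) - jacobian g (at z)) \<le> \<gamma> * norm (y - z)"
    and \<gamma>_nonneg: "\<gamma> \<ge> 0"
begin

lemma has_derivative: "(g has_derivative (*v) (jacobian g (at z))) (at z)"
  using differentiable jacobian_works by blast

lemma norm_jacobian_mult_le: "norm (jacobian g (at z) *v h) \<le> norm h"
  using norm_has_derivative_Lipschitz_le[OF has_derivative, of z 1] nonexpansive by simp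

lemma J_mat_mult: "J_mat g z *v v = jacobian g (at z) *v v - v"
proof -
  have resid: "(resid g has_derivative (\<lambda>h. jacobian g (at z) *v h - h)) (at z)"
    unfolding resid_def by (intro derivative_intros has_derivative)
  then have "(resid g has_derivative (*v) (J_mat g z)) (at z)"
    unfolding J_mat_def using differentiableI jacobian_works by blast
  from has_derivative_unique[OF this resid] show ?thesis
    by (rule fun_cong)
qed

text \<open>The GMRES space uses powers of \<open>J_mat\<close>, whereas \<open>G_mat\<close> uses
  powers of the Jacobian of \<open>g\<close>; the shift by the identity works in both
  directions.\<close>

lemma krylov_J_mat: "krylov n (J_mat g z) b = krylov n (jacobian g (at z)) b"
proof
  show "krylov n (J_mat g z) b \<subseteq> krylov n (jacobian g (at z)) b"
    by (rule krylov_shift_subset[where c = "-1"]) (simp add: J_mat_mult)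
  show "krylov n (jacobian g (at z)) b \<subseteq> krylov n (J_mat g z) b"
    by (rule krylov_shift_subset[where c = 1]) (simp add: J_mat_mult)
qed

lemma picard_step: "picard g z (Suc l) - picard g z l = resid g (picard g z l)"
  by (simp add: picard_def resid_def)

text \<open>Each residual is the increment of \<open>g\<close> over the preceding Picard step, and
  that step is the preceding residual.\<close>

lemma norm_resid_picard_le: "norm (resid g (picard g z l)) \<le> norm (resid g z)"
proof (induction l)
  case (Suc l)
  have "norm (resid g (picard g z (Suc l))) \<le> norm (picard g z (Suc l) - picard g z l)"
    using nonexpansive[of "picard g z (Suc l)" "picard g z l"] by (simp add: resid_def picard_def)
  with Suc show ?case by (simp add: picard_step)
qed (simp add: picard_def)

lemma norm_picard_diff_le: "norm (picard g z l - z) \<le> l * norm (resid g z)"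
proof (induction l)
  case (Suc l)
  have "picard g z (Suc l) - z = (picard g z l - z) + resid g (picard g z l)"
    by (simp flip: picard_step)
  then show ?case
    using norm_triangle_ineq[of "picard g z l - z" "resid g (picard g z l)"] Suc
      norm_resid_picard_le[of z l]
    by (simp add: algebra_simps)
qed (simp add: picard_def)

text \<open>The new residual is an increment of \<open>g\<close>, so the mean value inequality
  applies: the Jacobian varies by at most \<gamma> times the distance to \<open>z\<close>, and the
  step is no longer than \<open>norm (resid g z)\<close>. Both factors are linear in that
  norm.\<close>

lemma norm_resid_picard_linearization_le:
  "norm (resid g (picard g z (Suc l)) - jacobian g (at z) *v resid g (picard g z l))
    \<le> \<gamma> * Suc l * (norm (resid g z))\<^sup>2"
proof -
  let ?a = "picard g z l" and ?b = "picard g z (Suc l)" and ?\<phi> = "norm (resid g z)"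
  \<comment> \<open>The radius bounds the distance from \<open>z\<close> to the farther endpoint;
    convexity of the ball then covers the whole segment.\<close>
  let ?S = "cball z (Suc l * ?\<phi>)"
  have seg: "?a + s *\<^sub>R (?b - ?a) \<in> ?S" if "s \<in> {0..1}" for s
  proof -
    have "?a \<in> ?S"
      using norm_picard_diff_le[of z l] by (simp add: dist_norm norm_minus_commute algebra_simps)
        (smt (verit) norm_ge_zero)
    moreover have "?b \<in> ?S"
      using norm_picard_diff_le[of z "Suc l"] by (simp add: dist_norm norm_minus_commute)
    ultimately have "(1 - s) *\<^sub>R ?a + s *\<^sub>R ?b \<in> ?S"
      using that by (intro convexD[OF convex_cball]) auto
    then show ?thesis by (simp add: algebra_simps)
  qed
  have bound: "onorm ((*v) (jacobian g (at y)) - (*v) (jacobian g (at z))) \<le> \<gamma> * (Suc l * ?\<phi>)"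
    if "y \<in> ?S" for y
  proof -
    have "(*v) (jacobian g (at y)) - (*v) (jacobian g (at z)) = (*v) (jacobian g (at y) - jacobian g (at z))"
      by (auto simp: matrix_vector_mult_diff_rdistrib)
    then have "onorm ((*v) (jacobian g (at y)) - (*v) (jacobian g (at z))) \<le> \<gamma> * norm (y - z)"
      using jacobian_Lipschitz[of y z] by (simp add: matrix_norm_def)
    also have "\<dots> \<le> \<gamma> * (Suc l * ?\<phi>)"
      using that \<gamma>_nonneg by (intro mult_left_mono) (auto simp: dist_norm norm_minus_commute)
    finally show ?thesis .
  qed
  have "norm (g ?b - g ?a - jacobian g (at z) *v (?b - ?a)) \<le> norm (?b - ?a) * (\<gamma> * (Suc l * ?\<phi>))"
    by (rule differentiable_bound_linearization[where S = ?S and f' = "\<lambda>y. (*v) (jacobian g (at y))"])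
      (use seg bound has_derivative in \<open>auto intro: has_derivative_at_withinI\<close>)
  also have "\<dots> \<le> ?\<phi> * (\<gamma> * (Suc l * ?\<phi>))"
    using norm_resid_picard_le[of z l] \<gamma>_nonneg by (intro mult_right_mono) (auto simp: picard_step)
  also have "g ?b - g ?a = resid g ?b"
    by (simp add: resid_def picard_def)
  finally show ?thesis
    by (simp add: picard_step power2_eq_square mult_ac)
qed

text \<open>The Jacobian does not enlarge norms, so earlier errors propagate without growth and only
  the linearization errors add up; \<open>Suc l + l\<^sup>2 \<le> (Suc l)\<^sup>2\<close> keeps the
  bound in closed form.\<close>

lemma norm_resid_picard_krylov_le:
  "norm (resid g (picard g z l) - matrix_power (jacobian g (at z)) l *v resid g z)
    \<le> \<gamma> * l\<^sup>2 * (norm (resid g z))\<^sup>2"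
proof (induction l)
  case 0
  show ?case by (simp add: picard_def)
next
  case (Suc l)
  let ?A = "jacobian g (at z)" and ?f = "resid g z" and ?q = "\<gamma> * (norm (resid g z))\<^sup>2"
  have "resid g (picard g z (Suc l)) - matrix_power ?A (Suc l) *v ?f
      = (resid g (picard g z (Suc l)) - ?A *v resid g (picard g z l))
      + ?A *v (resid g (picard g z l) - matrix_power ?A l *v ?f)"
    by (simp add: matrix_vector_mult_diff_distrib flip: matrix_vector_mul_assoc)
  then have "norm (resid g (picard g z (Suc l)) - matrix_power ?A (Suc l) *v ?f)
      \<le> \<gamma> * Suc l * (norm ?f)\<^sup>2 + \<gamma> * l\<^sup>2 * (norm ?f)\<^sup>2"
    by (simp only:)
      (intro norm_triangle_mono norm_resid_picard_linearization_le
        order_trans[OF norm_jacobian_mult_le Suc])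
  also have "\<dots> = ?q * (Suc l + l\<^sup>2)"
    by (simp add: algebra_simps)
  also have "\<dots> \<le> ?q * (Suc l)\<^sup>2"
    using \<gamma>_nonneg by (intro mult_left_mono) (auto simp: power2_eq_square algebra_simps)
  finally show ?case by (simp add: mult_ac)
qed

text \<open>Since \<open>J_mat\<close> is the Jacobian minus the identity, a column of the product
  is a difference of consecutive Krylov vectors. The deviation is thus a difference of two errors
  with index at most \<open>m\<close>.\<close>

lemma norm_Y_col_diff_le:
  assumes "l < m"
  shows "norm (resid g (picard g z (Suc l)) - resid g (picard g z l)
      - J_mat g z *v (matrix_power (jacobian g (at z)) l *v resid g z))
    \<le> 2 * \<gamma> * m\<^sup>2 * (norm (resid g z))\<^sup>2"
proof -
  let ?A = "jacobian g (at z)" and ?f = "resid g z"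
  let ?e = "\<lambda>l. resid g (picard g z l) - matrix_power ?A l *v ?f"
  have e: "norm (?e l) \<le> \<gamma> * m\<^sup>2 * (norm ?f)\<^sup>2" if "l \<le> m" for l
  proof -
    have "norm (?e l) \<le> \<gamma> * l\<^sup>2 * (norm ?f)\<^sup>2"
      by (rule norm_resid_picard_krylov_le)
    also have "\<dots> \<le> \<gamma> * m\<^sup>2 * (norm ?f)\<^sup>2"
      using that \<gamma>_nonneg by (intro mult_right_mono mult_left_mono) (auto simp: power_mono)
    finally show ?thesis .
  qed
  have "norm (resid g (picard g z (Suc l)) - resid g (picard g z l)
      - J_mat g z *v (matrix_power ?A l *v ?f)) = norm (?e (Suc l) - ?e l)"
    by (rule arg_cong[where f = norm]) (simp add: J_mat_mult flip: matrix_vector_mul_assoc)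
  also have "\<dots> \<le> norm (?e (Suc l)) + norm (?e l)"
    by (rule norm_triangle_ineq4)
  also have "\<dots> \<le> \<gamma> * m\<^sup>2 * (norm ?f)\<^sup>2 + \<gamma> * m\<^sup>2 * (norm ?f)\<^sup>2"
    using assms by (intro add_mono e) auto
  finally show ?thesis by simp
qed

lemma norm_Y_mat_diff_le:
  fixes c :: "(real, 'm::{finite,linorder}) vec"
  shows "norm (Y_mat g z *v c - (J_mat g z ** G_mat g z) *v c)
    \<le> 2 * \<gamma> * real CARD('m) ^ 3 * (norm (resid g z))\<^sup>2 * norm c"
proof -
  have "norm (Y_mat g z *v c - (J_mat g z ** G_mat g z) *v c)
      \<le> real CARD('m) * (2 * \<gamma> * (real CARD('m))\<^sup>2 * (norm (resid g z))\<^sup>2) * norm c"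
    unfolding Y_mat_def G_mat_def matrix_mult_matrix_of_cols
    using norm_Y_col_diff_le[where m = "CARD('m)"]
    by (intro norm_matrix_of_cols_mult_diff_le) simp
  then show ?thesis by (simp add: power3_eq_cube power2_eq_square mult_ac)
qed

text \<open>The Krylov space is the range of \<open>G_mat\<close>, so its image under
  \<open>J_mat\<close> is the range of the product.\<close>

lemma gmres_resid_eq_infdist:
  "gmres_resid g CARD('m::{finite,linorder}) z
    = infdist (resid g z) (range ((*v) (J_mat g z ** (G_mat g z :: real^'m::{finite,linorder}^'d))))"
proof -
  let ?J = "J_mat g z" and ?G = "G_mat g z :: real^'m::{finite,linorder}^'d"
  have "krylov CARD('m) ?J (resid g z) = range ((*v) ?G)"
    unfolding krylov_J_mat by (simp add: krylov_def G_mat_def range_matrix_of_cols)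
  moreover have "range ((*v) (?J ** ?G)) = (*v) ?J ` range ((*v) ?G)"
    by (simp add: image_image flip: matrix_vector_mul_assoc)
  ultimately show ?thesis
    by (simp add: gmres_resid_def infdist_notempty image_image dist_norm norm_minus_commute)
qed

end

section \<open>Comparison of the two gains\<close>

lemma norm_mixed_resid_eq_infdist:
  fixes g :: "real^'d \<Rightarrow> real^'d"
  assumes "is_arg_min (\<lambda>a. (norm (mixed_resid g CARD('m::{finite,linorder}) z a))\<^sup>2)
      (\<lambda>a. (\<Sum>l\<le>CARD('m). a l) = 1) a"
  shows "norm (mixed_resid g CARD('m) z a)
    = infdist (resid g z) (range ((*v) (Y_mat g z :: real^'m::{finite,linorder}^'d)))"
proof -
  let ?R = "range ((*v) (Y_mat g z :: real^'m::{finite,linorder}^'d))"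
  let ?A = "{a. (\<Sum>l\<le>CARD('m). a l) = (1 :: real)}"
  have mixed: "mixed_resid g CARD('m) z ` ?A = (\<lambda>p. resid g z - p) ` ?R"
    using affine_combinations_eq_span_differences[where m = "CARD('m)"
        and u = "\<lambda>l. resid g (picard g z l)"]
    by (simp add: mixed_resid_def[abs_def] Y_mat_def range_matrix_of_cols picard_def[of g z 0]
        image_Collect)
  have a: "a \<in> ?A" "\<And>b. b \<in> ?A \<Longrightarrow> norm (mixed_resid g CARD('m) z a) \<le> norm (mixed_resid g CARD('m) z b)"
    using assms by (auto simp: is_arg_min_linorder)
  have "infdist (resid g z) ?R = (INF q\<in>(\<lambda>p. resid g z - p) ` ?R. norm q)"
    by (simp add: infdist_notempty image_image dist_norm)
  also have "\<dots> = (INF b\<in>?A. norm (mixed_resid g CARD('m) z b))"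
    unfolding mixed[symmetric] by (simp only: image_image)
  also have "\<dots> = norm (mixed_resid g CARD('m) z a)"
    by (rule cInf_eq_minimum) (use a in auto)
  finally show ?thesis by simp
qed

theorem theorem4p8:
  fixes g :: "real^'d \<Rightarrow> real^'d"
    and m T :: nat
    and \<kappa> \<gamma> M :: real
    and \<beta> :: "nat \<Rightarrow> real"
    and x :: "nat \<Rightarrow> real^'d"
    and \<alpha> :: "nat \<Rightarrow> nat \<Rightarrow> real"
  assumes g_diff: "\<And>z. g differentiable (at z)"
    and g_C1: "continuous_on UNIV (\<lambda>z. jacobian g (at z))"
    and m_card: "CARD('m::{finite,linorder}) = m"
    and m_pos: "1 \<le> m"
    and m_le_d: "m \<le> CARD('d)"
    and g_Lipschitz: "\<And>y z. norm (g y - g z) \<le> \<kappa> * norm (y - z)"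
    and \<kappa>_le_1: "\<kappa> \<le> 1"
    and g'_Lipschitz:
      "\<And>y z. matrix_norm (jacobian g (at y) - jacobian g (at z)) \<le> \<gamma> * norm (y - z)"
    and \<gamma>_pos: "\<gamma> > 0"
    and \<beta>_nonneg: "\<And>t. \<beta> t \<ge> 0"
    and run: "AAP g m \<beta> x \<alpha>"
    and S_rank: "\<And>t. full_column_rank (S_mat g (x t) :: real^'m::{finite,linorder}^'d)"
    and Y_rank: "\<And>t. full_column_rank (Y_mat g (x t) :: real^'m::{finite,linorder}^'d)"
    and T_pos: "T > 0"
    and M_pos: "M > 0"
    and J_inv: "\<And>t. t \<ge> T \<Longrightarrow> invertible (J_mat g (x t))"
    and Y_sigma:
      "\<And>t. t \<ge> T \<Longrightarrow> sigma_min (Y_mat g (x t) :: real^'m::{finite,linorder}^'d) \<ge> M * norm (resid g (x t))"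
    and JG_rank:
      "\<And>t. t \<ge> T \<Longrightarrow> full_column_rank (J_mat g (x t) ** (G_mat g (x t) :: real^'m::{finite,linorder}^'d))"
  shows "(\<exists>C>0. \<exists>\<delta>>0. \<forall>t\<ge>T. norm (resid g (x t)) \<le> \<delta> \<longrightarrow>
            \<bar>opt_gain g m (x t) (\<alpha> t) - gmres_gain g m (x t)\<bar> \<le> C * norm (resid g (x t)))
       \<and> (\<forall>\<epsilon>>0. \<exists>\<delta>>0. \<forall>t\<ge>T. norm (resid g (x t)) \<le> \<delta> \<longrightarrow>
            \<bar>opt_gain g m (x t) (\<alpha> t) - gmres_gain g m (x t)\<bar> < \<epsilon>)"
proof -
  interpret smooth_nonexpansive g \<gamma>
  proof
    show "norm (g y - g z) \<le> norm (y - z)" for y z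
      using g_Lipschitz[of y z] mult_right_mono[OF \<kappa>_le_1 norm_ge_zero[of "y - z"]] by simp
  qed (use g_diff g'_Lipschitz \<gamma>_pos in auto)
  \<comment> \<open>\<open>K\<close> is the constant of \<open>norm_Y_mat_diff_le\<close>. \<delta>
    makes \<open>K * norm f\<close> at most \<open>M / 2\<close>, and \<open>C\<close> is the
    perturbation cost \<open>2 * K / \<mu>\<close> for the weaker of the two lower bounds,
    \<open>\<mu> = M / 2\<close>.\<close>
  define K where "K = 2 * \<gamma> * real m ^ 3"
  define C where "C = 4 * K / M"
  define \<delta> where "\<delta> = M / (2 * K)"
  have "K > 0" using \<gamma>_pos m_pos by (simp add: K_def)
  then have "C > 0" "\<delta> > 0" using M_pos by (simp_all add: C_def \<delta>_def)
  have main: "\<bar>opt_gain g m (x t) (\<alpha> t) - gmres_gain g m (x t)\<bar> \<le> C * norm (resid g (x t))"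
    if "t \<ge> T" and small: "norm (resid g (x t)) \<le> \<delta>" for t
  proof (cases "resid g (x t) = 0")
    \<comment> \<open>Division by zero yields 0, so both gains vanish here.\<close>
    case True
    then show ?thesis by (simp add: opt_gain_def gmres_gain_def)
  next
    case False
    define f where "f = resid g (x t)"
    define Y where "Y = (Y_mat g (x t) :: real^'m::{finite,linorder}^'d)"
    define B where "B = J_mat g (x t) ** (G_mat g (x t) :: real^'m::{finite,linorder}^'d)"
    have f: "norm f > 0" using False by (simp add: f_def)
    have Y: "M * norm f * norm v \<le> norm (Y *v v)" for v
      using mult_right_mono[OF Y_sigma[OF \<open>t \<ge> T\<close>] norm_ge_zero[of v]] sigma_min_mult_norm_le[of Y v]
      unfolding Y_def f_def by linarith
    have close: "norm (Y *v v - B *v v) \<le> K * (norm f)\<^sup>2 * norm v" for v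
      using norm_Y_mat_diff_le[of "x t" v] by (simp add: Y_def B_def f_def K_def m_card)
    have "K * norm f \<le> M / 2"
      using small \<open>K > 0\<close> by (simp add: \<delta>_def f_def field_simps)
    then have K: "K * (norm f)\<^sup>2 \<le> M / 2 * norm f"
      using f by (simp add: power2_eq_square flip: mult.assoc)
    \<comment> \<open>The perturbation consumes at most half of the lower bound of \<open>Y\<close>,
      so the perturbation lemma also applies with the roles of \<open>Y\<close> and \<open>B\<close>
      exchanged.\<close>
    have B: "M / 2 * norm f * norm v \<le> norm (B *v v)" for v
      using Y[of v] close[of v] mult_right_mono[OF K norm_ge_zero[of v]]
        norm_triangle_ineq3[of "Y *v v" "B *v v"] by simp
    have "infdist f (range ((*v) B)) \<le> infdist f (range ((*v) Y))
        + 2 * (K * (norm f)\<^sup>2) * norm f / (M * norm f)"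
      using f M_pos \<open>K > 0\<close> by (intro infdist_range_perturbation Y close) auto
    moreover have "infdist f (range ((*v) Y)) \<le> infdist f (range ((*v) B))
        + 2 * (K * (norm f)\<^sup>2) * norm f / (M / 2 * norm f)"
      using f M_pos \<open>K > 0\<close> close
      by (intro infdist_range_perturbation B) (auto simp: norm_minus_commute)
    moreover have "2 * (K * (norm f)\<^sup>2) * norm f / (M / 2 * norm f) = C * (norm f)\<^sup>2"
      "2 * (K * (norm f)\<^sup>2) * norm f / (M * norm f) \<le> C * (norm f)\<^sup>2"
      using f M_pos \<open>K > 0\<close> by (simp_all add: C_def field_simps)
    ultimately have diff: "\<bar>infdist f (range ((*v) Y)) - infdist f (range ((*v) B))\<bar> \<le> C * (norm f)\<^sup>2"
      unfolding abs_le_iff by linarith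
    have "norm (mixed_resid g m (x t) (\<alpha> t)) = infdist f (range ((*v) Y))"
      using run norm_mixed_resid_eq_infdist[where 'm = 'm, of g "x t" "\<alpha> t"]
      by (simp add: AAP_def m_card f_def Y_def)
    moreover have "gmres_resid g m (x t) = infdist f (range ((*v) B))"
      using gmres_resid_eq_infdist[where 'm = 'm, of "x t"] by (simp add: m_card f_def B_def)
    ultimately have "\<bar>opt_gain g m (x t) (\<alpha> t) - gmres_gain g m (x t)\<bar>
        = \<bar>infdist f (range ((*v) Y)) - infdist f (range ((*v) B))\<bar> / norm f"
      by (simp add: opt_gain_def gmres_gain_def abs_divide flip: f_def diff_divide_distrib)
    also have "\<dots> \<le> C * norm f"
      using diff f by (simp add: field_simps power2_eq_square)
    finally show ?thesis by (simp add: f_def)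
  qed
  show ?thesis
  proof (intro conjI allI impI)
    show "\<exists>C>0. \<exists>\<delta>>0. \<forall>t\<ge>T. norm (resid g (x t)) \<le> \<delta> \<longrightarrow>
        \<bar>opt_gain g m (x t) (\<alpha> t) - gmres_gain g m (x t)\<bar> \<le> C * norm (resid g (x t))"
      using \<open>C > 0\<close> \<open>\<delta> > 0\<close> main by (intro exI[of _ C] exI[of _ \<delta>] conjI allI impI)
  next
    fix \<epsilon> :: real assume "\<epsilon> > 0"
    show "\<exists>\<delta>>0. \<forall>t\<ge>T. norm (resid g (x t)) \<le> \<delta> \<longrightarrow>
        \<bar>opt_gain g m (x t) (\<alpha> t) - gmres_gain g m (x t)\<bar> < \<epsilon>"
    \<comment> \<open>The factor 2 yields a strict inequality although the norm may equal the
      threshold.\<close>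
    proof (intro exI[of _ "min \<delta> (\<epsilon> / (2 * C))"] conjI allI impI)
      show "min \<delta> (\<epsilon> / (2 * C)) > 0"
        using \<open>\<epsilon> > 0\<close> \<open>\<delta> > 0\<close> \<open>C > 0\<close> by simp
    next
      fix t assume t: "t \<ge> T" and small: "norm (resid g (x t)) \<le> min \<delta> (\<epsilon> / (2 * C))"
      have "C * norm (resid g (x t)) \<le> \<epsilon> / 2"
        using small \<open>C > 0\<close> by (simp add: field_simps)
      moreover have "norm (resid g (x t)) \<le> \<delta>"
        using small by simp
      ultimately show "\<bar>opt_gain g m (x t) (\<alpha> t) - gmres_gain g m (x t)\<bar> < \<epsilon>"
        using main[OF t] \<open>\<epsilon> > 0\<close> by linarith
    qed
  qed
qed

end
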